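(* Let $A,B,H,K$ be any logically independent events. The set $\Pi$ of all the coherent assessments $(x,y,z,\mu)$ on the family $\mathcal{F}=\{A|H,\ B|K,\ (A|H)\wedge_{L}(B|K),\ (B|K)|_{L}(A|H)\}$ is $\Pi=\Pi'\cup\Pi''$, where $$\Pi'=\{(x,y,z,\mu): x\in(0,1],\ y\in[0,1],\ z\in[z',z''],\ \mu=\tfrac{z}{x}\},$$ with $z'=0$, $z''=\min\{x,y\}$, and $\Pi''=\{(0,y,0,\mu):(y,\mu)\in[0,1]^2\}$.
   Context: Events are two-valued entities identified with their indicators (values $1/0$); $\emptyset$ is the impossible event, $AB=A\wedge B$, $\overline{A}$ is the negation. Four events are logically independent if all $16$ conjunctions obtained by taking each event or its negation are different from $\emptyset$. For $H\neq\emptyset$ the conditional event $E|H$ is true if $EH$ is true, false if $\overline{E}H$ is true, void if $\overline{H}$ is true. Once $P(E|H)=p$ is assessed, $E|H$ is also the random quantity $EH+p\overline{H}$; numerically $\overline{A}|H=1-A|H$. Lukasiewicz conjunction (a conditional event): $(A|H)\wedge_L(B|K)=AHBK|(AHBK\vee\overline{A}H\vee\overline{B}K\vee\overline{H}\,\overline{K})$. Iterated conditional: $(B|K)|_L(A|H)$ is the random quantity $(A|H)\wedge_L(B|K)+\mu\,(\overline{A}|H)$, where $\mu=\mathbb{P}[(B|K)|_L(A|H)]$ is its assessed prevision (the amount paid to receive it), the right-hand side being computed numerically from $x=P(A|H)$, $z=P[(A|H)\wedge_L(B|K)]$ and $\mu$. Also $y=P(B|K)$. Coherence: an assessment of real values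 $m_j$ on a finite family of such objects $X_j$ (conditional events, as random quantities, and iterated conditionals) is coherent iff for every nonempty subfamily $J$ and all reals $s_j$, the random gain $\sum_{j\in J}s_j(X_j-m_j)$, restricted to the cases where at least one of the bets in $J$ is not called off, has minimum $\le 0$ and maximum $\ge 0$. A bet on a conditional event is called off when it is void; a bet on the iterated conditional is called off in the cases where one receives back the paid amount $\mu$ whatever $\mu$ is (taking into account the relation $z=x\mu$ required by linearity of coherent previsions). *)

theory Defs
  imports Complex_Main "HOL-Library.Indicator_Function"
begin

text \<open>
  Events are subsets of an arbitrary sample space, the universe of the type \<^typ>\<open>'w\<close>; the
  impossible event is the empty set, and a ``case'' is a point of the sample space.
\<close>

definition logically_independent4 :: "'w set \<Rightarrow> 'w set \<Rightarrow> 'w set \<Rightarrow> 'w set \<Rightarrow> bool" where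
  "logically_independent4 A B C D \<longleftrightarrow>
     (\<forall>a\<in>{A, -A}. \<forall>b\<in>{B, -B}. \<forall>c\<in>{C, -C}. \<forall>d\<in>{D, -D}. a \<inter> b \<inter> c \<inter> d \<noteq> {})"

text \<open>
  \<open>Cond E H\<close> is the conditional event \<open>E|H\<close>. It is meaningful for nonempty \<open>H\<close> only; when the
  four events are logically independent, this holds for all conditional events built from them below.
\<close>

datatype 'w cond_event = Cond (consequent: "'w set") (antecedent: "'w set")

definition void :: "'w cond_event \<Rightarrow> 'w set" where
  "void C = - antecedent C"

definition cond_neg :: "'w cond_event \<Rightarrow> 'w cond_event" where
  "cond_neg C = Cond (- consequent C) (antecedent C)"

fun luk_conj :: "'w cond_event \<Rightarrow> 'w cond_event \<Rightarrow> 'w cond_event" (infixl "\<and>\<^sub>L" 72) where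
  "Cond A H \<and>\<^sub>L Cond B K =
     Cond (A \<inter> H \<inter> B \<inter> K) ((A \<inter> H \<inter> B \<inter> K) \<union> (-A \<inter> H) \<union> (-B \<inter> K) \<union> (-H \<inter> -K))"

text \<open>The random quantity \<open>E|H\<close> once the probability \<open>p\<close> of \<open>E|H\<close> has been assessed.\<close>

definition cond_quantity :: "'w cond_event \<Rightarrow> real \<Rightarrow> 'w \<Rightarrow> real" where
  "cond_quantity C p \<omega> =
     indicator (consequent C \<inter> antecedent C) \<omega> + p * indicator (- antecedent C) \<omega>"

lemma cond_quantity_neg: "cond_quantity (cond_neg C) (1 - p) \<omega> = 1 - cond_quantity C p \<omega>"
  by (auto simp: cond_quantity_def cond_neg_def indicator_def)

text \<open>
  The iterated conditional \<open>(B|K) |\<^sub>L (A|H)\<close> is evaluated with \<open>D = B|K\<close>, \<open>C = A|H\<close>, and the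
  assessed values \<open>x\<close> of \<open>A|H\<close>, \<open>z\<close> of the conjunction and \<open>\<mu>\<close> of the iterated conditional.
\<close>

definition iter_quantity ::
    "'w cond_event \<Rightarrow> 'w cond_event \<Rightarrow> real \<Rightarrow> real \<Rightarrow> real \<Rightarrow> 'w \<Rightarrow> real" where
  "iter_quantity D C x z \<mu> \<omega> =
     cond_quantity (C \<and>\<^sub>L D) z \<omega> + \<mu> * cond_quantity (cond_neg C) (1 - x) \<omega>"

text \<open>
  A bet on the iterated conditional is called off where the paid amount is received back whatever
  that amount \<open>t\<close> is, the value of the conjunction being tied to it by \<open>z = x * t\<close>. The set of
  these cases depends on \<open>x\<close>.
\<close>

definition iter_called_off :: "'w cond_event \<Rightarrow> 'w cond_event \<Rightarrow> real \<Rightarrow> 'w set" where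
  "iter_called_off D C x = {\<omega>. \<forall>t. iter_quantity D C x (x * t) t \<omega> = t}"

lemma iter_called_off_simps:
  "x \<noteq> 0 \<Longrightarrow> x \<noteq> 1 \<Longrightarrow>
     iter_called_off (Cond B K) (Cond A H) x = (-A \<inter> H) \<union> (-H \<inter> B \<inter> K)"
  "iter_called_off (Cond B K) (Cond A H) 0 = (-A \<inter> H) \<union> -H"
  "iter_called_off (Cond B K) (Cond A H) 1 = (-A \<inter> H) \<union> (-H \<inter> B \<inter> K) \<union> (A \<inter> H \<inter> -K)"
proof -
  have *: "iter_quantity (Cond B K) (Cond A H) x (x * t) t \<omega> =
      (if \<omega> \<in> H then if \<omega> \<in> A then if \<omega> \<in> K then if \<omega> \<in> B then 1 else 0 else x * t else t
       else if \<omega> \<in> B \<inter> K then t else t - x * t)" for x t \<omega>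
    by (auto simp: iter_quantity_def cond_quantity_def cond_neg_def algebra_simps)
  have e1: "\<not> (\<forall>t::real. 1 = t)" "\<not> (\<forall>t::real. 0 = t)"
    by (metis zero_neq_one)+
  have e2: "(\<forall>t::real. x * t = t) \<longleftrightarrow> x = 1" "(\<forall>t::real. x * t = 0) \<longleftrightarrow> x = 0" for x
    by (metis mult.right_neutral mult_1, metis mult.right_neutral mult_zero_left)
  show "x \<noteq> 0 \<Longrightarrow> x \<noteq> 1 \<Longrightarrow>
     iter_called_off (Cond B K) (Cond A H) x = (-A \<inter> H) \<union> (-H \<inter> B \<inter> K)"
   "iter_called_off (Cond B K) (Cond A H) 0 = (-A \<inter> H) \<union> -H"
   "iter_called_off (Cond B K) (Cond A H) 1 = (-A \<inter> H) \<union> (-H \<inter> B \<inter> K) \<union> (A \<inter> H \<inter> -K)"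
    unfolding iter_called_off_def * using e1
    by (auto simp: e2 split: if_splits)
qed

datatype 'w bet_object =
    Ev "'w cond_event"
  | Iter "'w cond_event" "'w cond_event"  (infix "|\<^sub>L" 60)

text \<open>
  An assessment gives a real value to each object. An iterated conditional is evaluated with the
  values of its antecedent and of the conjunction, so a family containing \<open>D |\<^sub>L C\<close> is supposed to
  contain \<open>Ev C\<close> and \<open>Ev (C \<and>\<^sub>L D)\<close> too.
\<close>

fun quantity :: "('w bet_object \<Rightarrow> real) \<Rightarrow> 'w bet_object \<Rightarrow> 'w \<Rightarrow> real" where
  "quantity m (Ev C) = cond_quantity C (m (Ev C))"
| "quantity m (D |\<^sub>L C) = iter_quantity D C (m (Ev C)) (m (Ev (C \<and>\<^sub>L D))) (m (D |\<^sub>L C))"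

fun called_off :: "('w bet_object \<Rightarrow> real) \<Rightarrow> 'w bet_object \<Rightarrow> 'w set" where
  "called_off m (Ev C) = void C"
| "called_off m (D |\<^sub>L C) = iter_called_off D C (m (Ev C))"

definition gain ::
    "('w bet_object \<Rightarrow> real) \<Rightarrow> 'w bet_object set \<Rightarrow> ('w bet_object \<Rightarrow> real) \<Rightarrow> 'w \<Rightarrow> real" where
  "gain m J s \<omega> = (\<Sum>X\<in>J. s X * (quantity m X \<omega> - m X))"

text \<open>
  Each gain takes finitely many values, so its minimum and maximum exist even on an infinite
  sample space, as soon as the bets are not all called off everywhere.
\<close>

definition coherent :: "'w bet_object set \<Rightarrow> ('w bet_object \<Rightarrow> real) \<Rightarrow> bool" where
  "coherent F m \<longleftrightarrow>
     (\<forall>J s. J \<subseteq> F \<and> finite J \<and> J \<noteq> {} \<longrightarrow>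
        (let G = gain m J s ` {\<omega>. \<exists>X\<in>J. \<omega> \<notin> called_off m X}
         in Min G \<le> 0 \<and> Max G \<ge> 0))"

end

theory Submission
  imports Defs
begin

text \<open>
  Write \<open>x, y, z, \<mu>\<close> for the values of \<open>A|H\<close>, \<open>B|K\<close>, their conjunction and the iterated
  conditional. Both sets in the claim together amount to the single system
  \<open>x, y, \<mu> \<in> [0,1]\<close>, \<open>0 \<le> z \<le> min x y\<close>, \<open>z = x \<mu>\<close>: for \<open>x > 0\<close> the last equation determines \<open>\<mu>\<close>
  and \<open>z \<le> x\<close> bounds it, for \<open>x = 0\<close> it forces \<open>z = 0\<close> and leaves \<open>\<mu>\<close> free in \<open>[0,1]\<close>.

  Each condition is necessary because its failure can be exploited by a combination of bets that
  wins whenever it is not called off. Single bets give the unit intervals. A bet on \<open>A|H\<close> against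
  the conjunction gives \<open>z \<le> x\<close>, since the conjunction implies \<open>A|H\<close> in the sense of Goodman and
  Nguyen (\<open>coherent_mono\<close>); likewise \<open>z \<le> y\<close>. The bets that undo the definition of the iterated
  conditional have the constant gain \<open>z - x \<mu>\<close> (\<open>coherent_iterated_eq\<close>).

  The system is sufficient because a finitely supported mass distribution under which all bets of
  a subfamily are fair, and which does not put all its mass where they are called off, excludes a
  gain of constant strict sign (\<open>coherent_if_fair_distributions\<close>). When \<open>z = x \<mu>\<close>, the bet on the iterated
  conditional is a linear combination of the bets on \<open>A|H\<close> and on the conjunction, so it is fair
  as soon as they are. One distribution therefore serves all subfamilies that contain a
  conditional event: it gives mass 1 to each of the events \<open>H\<close>, \<open>K\<close> and the antecedent of the
  conjunction, and it realises the whole interval \<open>0 \<le> z \<le> min x y\<close> because it can use the cases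
  where \<open>A|H\<close> is true and \<open>B|K\<close> is void, or vice versa, in which the conjunction is void. The only
  remaining subfamily is the iterated conditional alone; there one concentrates on \<open>A H K\<close> and
  gives \<open>B\<close> the mass \<open>\<mu>\<close>. For \<open>x = 0\<close> this second distribution is indispensable, as the bet is
  then called off outside \<open>A H\<close>, a null event under the first one.
\<close>

section \<open>Sure gains and fair distributions\<close>

lemma finite_range_combine:
  assumes "finite (range f)" "finite (range g)"
  shows "finite (range (\<lambda>\<omega>. h (f \<omega>) (g \<omega>)))"
proof (rule finite_subset)
  show "range (\<lambda>\<omega>. h (f \<omega>) (g \<omega>)) \<subseteq> (\<lambda>(a, b). h a b) ` (range f \<times> range g)"
    by auto
qed (use assms in simp)

lemma cond_quantity_value:
  "cond_quantity C p \<omega>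
     = (if \<omega> \<in> antecedent C then if \<omega> \<in> consequent C then 1 else 0 else p)"
  by (simp add: cond_quantity_def)

lemma finite_range_cond_quantity: "finite (range (cond_quantity C p))"
  by (rule finite_subset[of _ "{0, 1, p}"]) (auto simp: cond_quantity_value)

lemma finite_range_quantity: "finite (range (quantity m X))"
proof (cases X)
  case (Ev C)
  then show ?thesis by (simp add: finite_range_cond_quantity)
next
  case (Iter D C)
  have "finite (range (\<lambda>\<omega>. cond_quantity (C \<and>\<^sub>L D) z \<omega> + \<mu> * cond_quantity (cond_neg C) q \<omega>))"
    for z \<mu> q :: real
    by (rule finite_range_combine) (rule finite_range_cond_quantity)+
  then show ?thesis by (simp add: Iter iter_quantity_def[abs_def])
qed

lemma finite_range_gain: "finite J \<Longrightarrow> finite (range (gain m J s))"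
proof (induction J rule: finite_induct)
  case empty
  have "gain m {} s = (\<lambda>_. 0)" by (simp add: gain_def fun_eq_iff)
  then show ?case by simp
next
  case (insert X J)
  have "gain m (insert X J) s = (\<lambda>\<omega>. s X * (quantity m X \<omega> - m X) + gain m J s \<omega>)"
    using insert by (simp add: gain_def fun_eq_iff)
  then show ?case
    using finite_range_combine[OF finite_range_quantity insert.IH,
        where h = "\<lambda>q g. s X * (q - m X) + g"] by simp
qed

lemma finite_image_gain: "finite J \<Longrightarrow> finite (gain m J s ` S)"
  by (rule finite_subset[OF _ finite_range_gain]) auto

text \<open>
  Only losses are needed in this form of coherence, because changing the sign of all stakes
  turns a sure loss into a sure gain.
\<close>

lemma coherent_no_sure_gain:
  assumes "coherent F m" "J \<subseteq> F" "finite J" "X \<in> J" "\<omega> \<notin> called_off m X"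
  obtains Y \<omega>' where "Y \<in> J" "\<omega>' \<notin> called_off m Y" "gain m J s \<omega>' \<le> 0"
proof -
  let ?S = "{\<omega>. \<exists>X\<in>J. \<omega> \<notin> called_off m X}"
  have "Min (gain m J s ` ?S) \<le> 0"
    using assms unfolding coherent_def Let_def by blast
  moreover have "Min (gain m J s ` ?S) \<in> gain m J s ` ?S"
    using assms by (intro Min_in finite_image_gain) auto
  ultimately show thesis using that by auto
qed

text \<open>
  A distribution is a list of weighted sample points, which need not be distinct. The first
  assumption says that a bet which is called off gains nothing; so the mass on the cases where
  all bets are called off does not contribute to the mean gain.
\<close>

lemma coherent_if_fair_distributions:
  fixes m :: "'w bet_object \<Rightarrow> real"
  assumes off: "\<And>X \<omega>. X \<in> F \<Longrightarrow> \<omega> \<in> called_off m X \<Longrightarrow> quantity m X \<omega> = m X"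
  assumes fair: "\<And>J. J \<subseteq> F \<Longrightarrow> J \<noteq> {} \<Longrightarrow> \<exists>L.
      (\<forall>(w, \<omega>)\<in>set L. 0 \<le> w) \<and>
      (\<forall>X\<in>J. (\<Sum>(w, \<omega>)\<leftarrow>L. w * (quantity m X \<omega> - m X)) = 0) \<and>
      (\<exists>X\<in>J. \<exists>(w, \<omega>)\<in>set L. 0 < w \<and> \<omega> \<notin> called_off m X)"
  shows "coherent F m"
proof -
  have loss: "\<exists>\<omega>. (\<exists>X\<in>J. \<omega> \<notin> called_off m X) \<and> gain m J s \<omega> \<le> 0"
    if J: "J \<subseteq> F" "J \<noteq> {}" for J s
  proof (rule ccontr)
    assume "\<not> ?thesis"
    then have pos: "0 < gain m J s \<omega>" if "X \<in> J" "\<omega> \<notin> called_off m X" for X \<omega>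
      using that by (meson not_le)
    obtain L :: "(real \<times> 'w) list" where L:
        "\<And>w \<omega>. (w, \<omega>) \<in> set L \<Longrightarrow> 0 \<le> w"
        "\<And>X. X \<in> J \<Longrightarrow> (\<Sum>(w, \<omega>)\<leftarrow>L. w * (quantity m X \<omega> - m X)) = 0"
        "\<exists>X\<in>J. \<exists>(w, \<omega>)\<in>set L. 0 < w \<and> \<omega> \<notin> called_off m X"
      using fair[OF J] by fast
    have nonneg: "0 \<le> gain m J s \<omega>" for \<omega>
    proof (cases "\<exists>X\<in>J. \<omega> \<notin> called_off m X")
      case True
      then show ?thesis using pos less_imp_le by blast
    next
      case False
      then have "quantity m X \<omega> = m X" if "X \<in> J" for X
        using off J that by blast
      then show ?thesis by (simp add: gain_def)
    qed
    have "(\<Sum>(w, \<omega>)\<leftarrow>L'. w * gain m J s \<omega>)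
        = (\<Sum>X\<in>J. s X * (\<Sum>(w, \<omega>)\<leftarrow>L'. w * (quantity m X \<omega> - m X)))" for L'
      by (induction L')
        (auto simp: gain_def sum_distrib_left sum.distrib algebra_simps sum_subtractf)
    then have mean: "(\<Sum>(w, \<omega>)\<leftarrow>L. w * gain m J s \<omega>) = 0"
      using L(2) by simp
    obtain X w \<omega> where X: "X \<in> J" "(w, \<omega>) \<in> set L" "0 < w" "\<omega> \<notin> called_off m X"
      using L(3) by blast
    have "w * gain m J s \<omega> \<le> (\<Sum>(w, \<omega>)\<leftarrow>L. w * gain m J s \<omega>)"
      using X(2) L(1) nonneg
      by (intro member_le_sum_list) (force intro: mult_nonneg_nonneg)+
    moreover have "0 < w * gain m J s \<omega>"
      using X pos by simp
    ultimately show False using mean by simp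
  qed
  show ?thesis
    unfolding coherent_def Let_def
  proof (intro allI impI conjI; elim conjE)
    fix J s assume J: "J \<subseteq> F" "finite J" "J \<noteq> {}"
    let ?S = "{\<omega>. \<exists>X\<in>J. \<omega> \<notin> called_off m X}"
    obtain \<omega> where "\<omega> \<in> ?S" "gain m J s \<omega> \<le> 0"
      using loss[OF J(1,3)] by blast
    then show "Min (gain m J s ` ?S) \<le> 0"
      using Min_le[OF finite_image_gain[OF J(2)]] by (meson imageI order_trans)
    obtain \<omega> where "\<omega> \<in> ?S" "gain m J (\<lambda>X. - s X) \<omega> \<le> 0"
      using loss[OF J(1,3)] by blast
    moreover have "gain m J (\<lambda>X. - s X) \<omega> = - gain m J s \<omega>" for \<omega>
      by (simp add: gain_def sum_negf)
    ultimately have "\<omega> \<in> ?S" "0 \<le> gain m J s \<omega>" by simp_all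
    then show "0 \<le> Max (gain m J s ` ?S)"
      using Max_ge[OF finite_image_gain[OF J(2)]] by (meson imageI order_trans)
  qed
qed

section \<open>Necessary conditions\<close>

lemma coherent_cond_event_bounds:
  assumes "coherent F m" "Ev C \<in> F" "antecedent C \<noteq> {}"
  shows "0 \<le> m (Ev C)" "m (Ev C) \<le> 1"
proof -
  obtain \<omega> where "\<omega> \<in> antecedent C" using assms(3) by blast
  then have \<omega>: "\<omega> \<notin> called_off m (Ev C)" by (simp add: void_def)
  note no_gain = coherent_no_sure_gain[OF assms(1) _ _ _ \<omega>, of "{Ev C}"]
  show "0 \<le> m (Ev C)"
    by (rule no_gain[of "\<lambda>_. 1"])
      (use assms(2) in \<open>auto simp: gain_def void_def cond_quantity_value split: if_splits\<close>)
  show "m (Ev C) \<le> 1"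
    by (rule no_gain[of "\<lambda>_. -1"])
      (use assms(2) in \<open>auto simp: gain_def void_def cond_quantity_value split: if_splits\<close>)
qed

text \<open>
  The two inclusions are the Goodman-Nguyen order on conditional events: \<open>D\<close> is true whenever \<open>C\<close>
  is true, and \<open>C\<close> is false whenever \<open>D\<close> is false. If \<open>C\<close> cost more than \<open>D\<close>, buying \<open>D\<close> and
  selling \<open>C\<close> would win for certain, also in the cases where just one of them is void, since both
  values lie in the unit interval.
\<close>

lemma coherent_mono:
  assumes coh: "coherent F m" and F: "Ev C \<in> F" "Ev D \<in> F"
    and ne: "antecedent C \<noteq> {}" "antecedent D \<noteq> {}"
    and true: "consequent C \<inter> antecedent C \<subseteq> consequent D \<inter> antecedent D"
    and false: "- consequent D \<inter> antecedent D \<subseteq> - consequent C \<inter> antecedent C"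
  shows "m (Ev C) \<le> m (Ev D)"
proof (rule ccontr)
  assume less: "\<not> m (Ev C) \<le> m (Ev D)"
  then have neq: "C \<noteq> D" by auto
  note C = coherent_cond_event_bounds[OF coh F(1) ne(1)]
  note D = coherent_cond_event_bounds[OF coh F(2) ne(2)]
  define s where "s = (\<lambda>X. if X = Ev D then 1 else (-1::real))"
  obtain \<omega> where "\<omega> \<in> antecedent C" using ne(1) by blast
  then have "\<omega> \<notin> called_off m (Ev C)" by (simp add: void_def)
  then obtain Y \<omega> where Y: "Y \<in> {Ev C, Ev D}" "\<omega> \<notin> called_off m Y"
      and gain: "gain m {Ev C, Ev D} s \<omega> \<le> 0"
    using coherent_no_sure_gain[OF coh, of "{Ev C, Ev D}" "Ev C" \<omega> s] F by auto
  have "gain m {Ev C, Ev D} s \<omega>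
      = (cond_quantity D (m (Ev D)) \<omega> - m (Ev D)) - (cond_quantity C (m (Ev C)) \<omega> - m (Ev C))"
    using neq by (simp add: gain_def s_def)
  moreover have "\<omega> \<in> antecedent C \<or> \<omega> \<in> antecedent D"
    using Y by (auto simp: void_def)
  moreover have "\<omega> \<in> consequent C \<Longrightarrow> \<omega> \<in> antecedent C \<Longrightarrow>
      \<omega> \<in> consequent D \<and> \<omega> \<in> antecedent D"
    "\<omega> \<notin> consequent D \<Longrightarrow> \<omega> \<in> antecedent D \<Longrightarrow> \<omega> \<notin> consequent C \<and> \<omega> \<in> antecedent C"
    using true false by auto
  ultimately show False
    using gain less C D by (auto simp: cond_quantity_value split: if_splits)
qed

lemma iter_quantity_eq:
  "iter_quantity D C x z \<mu> \<omega> = cond_quantity (C \<and>\<^sub>L D) z \<omega> + \<mu> * (1 - cond_quantity C x \<omega>)"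
  by (simp add: iter_quantity_def cond_quantity_neg)

text \<open>
  Buying the iterated conditional, selling the conjunction and buying \<open>\<mu>\<close> units of the antecedent
  cancels all random parts in the definition of the iterated conditional.
\<close>

lemma coherent_iterated_eq:
  assumes coh: "coherent F m"
    and F: "Ev C \<in> F" "Ev (C \<and>\<^sub>L D) \<in> F" "D |\<^sub>L C \<in> F"
    and ne: "antecedent C \<noteq> {}" and neq: "C \<and>\<^sub>L D \<noteq> C"
  shows "m (Ev (C \<and>\<^sub>L D)) = m (Ev C) * m (D |\<^sub>L C)"
proof -
  let ?J = "{Ev C, Ev (C \<and>\<^sub>L D), D |\<^sub>L C}"
  define s where "s = (\<lambda>X. if X = Ev C then m (D |\<^sub>L C) else if X = D |\<^sub>L C then 1 else -1)"
  have gain: "gain m ?J (\<lambda>X. c * s X) \<omega> = c * (m (Ev (C \<and>\<^sub>L D)) - m (Ev C) * m (D |\<^sub>L C))" for c \<omega>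
    using neq by (simp add: gain_def s_def iter_quantity_eq algebra_simps)
  obtain \<omega> where "\<omega> \<in> antecedent C" using ne by blast
  then have "\<omega> \<notin> called_off m (Ev C)" by (simp add: void_def)
  from coherent_no_sure_gain[OF coh _ _ _ this, of ?J] F
  have "c * (m (Ev (C \<and>\<^sub>L D)) - m (Ev C) * m (D |\<^sub>L C)) \<le> 0" for c
    unfolding gain[symmetric] by (metis empty_subsetI finite.simps gain insertI1 insert_subset)
  from this[of 1] this[of "-1"] show ?thesis by simp
qed

section \<open>The coherent assessments\<close>

lemma logically_independent4_point:
  assumes "logically_independent4 A B C D"
  shows "\<exists>\<omega>. (\<omega> \<in> A \<longleftrightarrow> a) \<and> (\<omega> \<in> B \<longleftrightarrow> b) \<and> (\<omega> \<in> C \<longleftrightarrow> c) \<and> (\<omega> \<in> D \<longleftrightarrow> d)"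
proof -
  have "(if a then A else -A) \<inter> (if b then B else -B) \<inter> (if c then C else -C)
      \<inter> (if d then D else -D) \<noteq> {}"
    using assms unfolding logically_independent4_def by (auto simp del: Compl_disjoint)
  then show ?thesis by (auto split: if_splits)
qed

text \<open>
  With the relation \<open>z = x \<mu>\<close> in place of \<open>\<mu> = z / x\<close>, the degenerate assessments \<open>x = 0\<close> need no
  description of their own.
\<close>

lemma coherent_iff:
  fixes A B H K :: "'w set" and m :: "'w bet_object \<Rightarrow> real"
  assumes indep: "logically_independent4 A B H K"
  defines "x \<equiv> m (Ev (Cond A H))" and "y \<equiv> m (Ev (Cond B K))"
    and "z \<equiv> m (Ev (Cond A H \<and>\<^sub>L Cond B K))" and "\<mu> \<equiv> m (Cond B K |\<^sub>L Cond A H)"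
  shows "coherent {Ev (Cond A H), Ev (Cond B K), Ev (Cond A H \<and>\<^sub>L Cond B K),
                   Cond B K |\<^sub>L Cond A H} m
     \<longleftrightarrow> x \<in> {0..1} \<and> y \<in> {0..1} \<and> z \<in> {0..min x y} \<and> \<mu> \<in> {0..1} \<and> z = x * \<mu>"
    (is "coherent ?F m \<longleftrightarrow> _")
proof -
  let ?C = "Cond A H" and ?D = "Cond B K"
  have "\<forall>a b h k. \<exists>\<omega>. (\<omega> \<in> A \<longleftrightarrow> a) \<and> (\<omega> \<in> B \<longleftrightarrow> b) \<and> (\<omega> \<in> H \<longleftrightarrow> h) \<and> (\<omega> \<in> K \<longleftrightarrow> k)"
    using logically_independent4_point[OF indep] by blast
  then obtain pt where pt: "pt a b h k \<in> A \<longleftrightarrow> a" "pt a b h k \<in> B \<longleftrightarrow> b"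
      "pt a b h k \<in> H \<longleftrightarrow> h" "pt a b h k \<in> K \<longleftrightarrow> k" for a b h k
    by metis
  have ne: "antecedent ?C \<noteq> {}" "antecedent ?D \<noteq> {}" "antecedent (?C \<and>\<^sub>L ?D) \<noteq> {}"
    using pt(3)[of True True True True] pt(4)[of True True True True]
      pt[of True True True True] by auto
  have "pt False False False False \<in> antecedent (?C \<and>\<^sub>L ?D) - antecedent ?C"
    by (simp add: pt)
  then have neq: "?C \<and>\<^sub>L ?D \<noteq> ?C" by auto
  have q: "quantity m (Ev ?C) = cond_quantity ?C x" "quantity m (Ev ?D) = cond_quantity ?D y"
      "quantity m (Ev (?C \<and>\<^sub>L ?D)) = cond_quantity (?C \<and>\<^sub>L ?D) z"
    by (simp_all only: quantity.simps x_def y_def z_def)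
  \<comment> \<open>Every bet on the iterated conditional is a combination of two other bets, and it can be
    called off only where it gains nothing.\<close>
  have iter: "quantity m (?D |\<^sub>L ?C) \<omega> - \<mu>
      = (quantity m (Ev (?C \<and>\<^sub>L ?D)) \<omega> - z) - \<mu> * (quantity m (Ev ?C) \<omega> - x)"
    if "z = x * \<mu>" for \<omega>
    using that unfolding x_def z_def \<mu>_def by (simp add: iter_quantity_eq algebra_simps)
  have iter_off: "quantity m (?D |\<^sub>L ?C) \<omega> = \<mu>"
    if "z = x * \<mu>" "\<omega> \<in> called_off m (?D |\<^sub>L ?C)" for \<omega>
    using that unfolding x_def z_def \<mu>_def by (simp add: iter_called_off_def)
  \<comment> \<open>The values of the iterated conditional on \<open>A H K\<close>, where the bet stands for every \<open>x\<close>.\<close>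
  have AHK_on: "pt True b True True \<notin> called_off m (?D |\<^sub>L ?C)" for b
    by (cases b) (auto simp: iter_called_off_def iter_quantity_def cond_quantity_value cond_neg_def
        pt intro: exI[of _ "2::real"])
  have AHK: "quantity m (?D |\<^sub>L ?C) (pt True b True True) = of_bool b" for b
    by (simp add: iter_quantity_eq cond_quantity_value pt)
  show ?thesis
  proof
    assume coh: "coherent ?F m"
    have x: "0 \<le> x" "x \<le> 1" and y: "0 \<le> y" "y \<le> 1" and z: "0 \<le> z"
      unfolding x_def y_def z_def
      using coherent_cond_event_bounds[OF coh] ne by simp_all
    have zx: "z \<le> x"
      unfolding x_def z_def using ne by (intro coherent_mono[OF coh]) auto
    have zy: "z \<le> y"
      unfolding y_def z_def using ne by (intro coherent_mono[OF coh]) auto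
    have z_eq: "z = x * \<mu>"
      unfolding x_def z_def \<mu>_def using ne neq by (intro coherent_iterated_eq[OF coh]) auto
    have "0 \<le> \<mu> \<and> \<mu> \<le> 1"
    proof (cases "x = 0")
      case True
      \<comment> \<open>The bet now stands exactly on \<open>A H\<close>, where it pays 1, 0, or \<open>z = 0\<close>.\<close>
      then have z0: "z = 0" using z_eq by simp
      have loss: "\<exists>v\<in>{0, 1}. s * (v - \<mu>) \<le> 0" for s :: real
      proof (rule coherent_no_sure_gain[OF coh _ _ _ AHK_on,
            where J = "{?D |\<^sub>L ?C}" and s = "\<lambda>_. s"])
        fix Y \<omega>
        assume Y: "Y \<in> {?D |\<^sub>L ?C}" "\<omega> \<notin> called_off m Y"
          and gain: "gain m {?D |\<^sub>L ?C} (\<lambda>_. s) \<omega> \<le> 0"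
        have "\<omega> \<in> A \<inter> H"
          using Y True by (auto simp: x_def[symmetric] iter_called_off_simps)
        then have "quantity m (?D |\<^sub>L ?C) \<omega> \<in> {0, 1}"
          using z0 by (auto simp: iter_quantity_eq cond_quantity_value z_def)
        moreover have "s * (quantity m (?D |\<^sub>L ?C) \<omega> - \<mu>) \<le> 0"
          using gain by (simp add: gain_def \<mu>_def)
        ultimately show ?thesis by blast
      qed auto
      from loss[of 1] loss[of "-1"] show ?thesis by auto
    next
      case False
      then have "0 < x" using x by simp
      then show ?thesis
        using z zx z_eq by (auto simp: zero_le_mult_iff)
    qed
    then show "x \<in> {0..1} \<and> y \<in> {0..1} \<and> z \<in> {0..min x y} \<and> \<mu> \<in> {0..1} \<and> z = x * \<mu>"
      using x y z zx zy z_eq by simp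
  next
    assume "x \<in> {0..1} \<and> y \<in> {0..1} \<and> z \<in> {0..min x y} \<and> \<mu> \<in> {0..1} \<and> z = x * \<mu>"
    then have x: "0 \<le> x" "x \<le> 1" and y: "0 \<le> y" "y \<le> 1" and z: "0 \<le> z" "z \<le> x" "z \<le> y"
      and \<mu>: "0 \<le> \<mu>" "\<mu> \<le> 1" and z_eq: "z = x * \<mu>"
      by auto
    \<comment> \<open>The masses of \<open>H\<close>, \<open>K\<close> and of the antecedent of the conjunction are all 1. The false
      cases of \<open>A|H\<close> and of \<open>B|K\<close>, with masses \<open>1 - x\<close> and \<open>1 - y\<close>, overlap as much as possible;
      they fill \<open>1 - min x y\<close>, which leaves room for every \<open>z \<le> min x y\<close>.\<close>
    define P where "P =
      [(z, pt True True True True), (x - z, pt True True True False),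
       (y - z, pt True True False True), (1 - max x y, pt False False True True),
       (max x y - x, pt False True True False), (max x y - y, pt True False False True),
       (min x y - z, pt True True False False)]"
    have P_nonneg: "\<forall>(w, \<omega>)\<in>set P. 0 \<le> w"
      using x y z by (auto simp: P_def)
    have P_C: "(\<Sum>(w, \<omega>)\<leftarrow>P. w * (quantity m (Ev ?C) \<omega> - x)) = 0"
      unfolding P_def q by (simp add: cond_quantity_value pt algebra_simps)
    have P_D: "(\<Sum>(w, \<omega>)\<leftarrow>P. w * (quantity m (Ev ?D) \<omega> - y)) = 0"
      unfolding P_def q by (simp add: cond_quantity_value pt algebra_simps)
    have P_CD: "(\<Sum>(w, \<omega>)\<leftarrow>P. w * (quantity m (Ev (?C \<and>\<^sub>L ?D)) \<omega> - z)) = 0"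
      unfolding P_def q by (simp add: cond_quantity_value pt algebra_simps max_def min_def)
    have P_iter: "(\<Sum>(w, \<omega>)\<leftarrow>P. w * (quantity m (?D |\<^sub>L ?C) \<omega> - \<mu>)) = 0"
    proof -
      have "(\<Sum>(w, \<omega>)\<leftarrow>P. w * (quantity m (?D |\<^sub>L ?C) \<omega> - \<mu>))
          = (\<Sum>(w, \<omega>)\<leftarrow>P. w * (quantity m (Ev (?C \<and>\<^sub>L ?D)) \<omega> - z))
          - \<mu> * (\<Sum>(w, \<omega>)\<leftarrow>P. w * (quantity m (Ev ?C) \<omega> - x))" for P
        unfolding iter[OF z_eq] by (induction P) (auto simp: algebra_simps)
      then show ?thesis using P_C P_CD by simp
    qed
    have P_fair: "(\<Sum>(w, \<omega>)\<leftarrow>P. w * (quantity m X \<omega> - m X)) = 0" if "X \<in> ?F" for X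
      using that P_C P_D P_CD P_iter unfolding x_def y_def z_def \<mu>_def by blast
    \<comment> \<open>Not all masses on an antecedent vanish, since they add up to 1.\<close>
    have P_on: "\<exists>(w, \<omega>)\<in>set P. 0 < w \<and> \<omega> \<notin> called_off m (Ev E)"
      if E: "Ev E \<in> ?F" for E
    proof -
      consider "E = ?C" | "E = ?D" | "E = ?C \<and>\<^sub>L ?D" using E by blast
      then show ?thesis
      proof cases
        case 1
        have "0 < z \<or> 0 < x - z \<or> 0 < 1 - max x y \<or> 0 < max x y - x"
          using z by linarith
        with 1 show ?thesis by (auto simp: P_def void_def pt)
      next
        case 2
        have "0 < z \<or> 0 < y - z \<or> 0 < 1 - max x y \<or> 0 < max x y - y"
          using z by linarith
        with 2 show ?thesis by (auto simp: P_def void_def pt)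
      next
        case 3
        have "0 < z \<or> 0 < 1 - max x y \<or> 0 < max x y - x \<or> 0 < max x y - y \<or> 0 < min x y - z"
          using z by linarith
        with 3 show ?thesis by (auto simp: P_def void_def pt)
      qed
    qed
    define Q where "Q = [(\<mu>, pt True True True True), (1 - \<mu>, pt True False True True)]"
    show "coherent ?F m"
    proof (rule coherent_if_fair_distributions)
      fix X \<omega> assume "X \<in> ?F" "\<omega> \<in> called_off m X"
      then show "quantity m X \<omega> = m X"
        using iter_off[OF z_eq, of \<omega>] unfolding \<mu>_def
        by (auto simp: void_def cond_quantity_value simp del: quantity.simps(2) called_off.simps(2)
            luk_conj.simps)
    next
      fix J assume J: "J \<subseteq> ?F" "J \<noteq> {}"
      let ?fair = "\<lambda>L. (\<forall>(w, \<omega>)\<in>set L. 0 \<le> w) \<and>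
        (\<forall>X\<in>J. (\<Sum>(w, \<omega>)\<leftarrow>L. w * (quantity m X \<omega> - m X)) = 0) \<and>
        (\<exists>X\<in>J. \<exists>(w, \<omega>)\<in>set L. 0 < w \<and> \<omega> \<notin> called_off m X)"
      show "\<exists>L. ?fair L"
      proof (cases "\<exists>E. Ev E \<in> J")
        case True
        then obtain E where E: "Ev E \<in> J" ..
        have "?fair P"
        proof (intro conjI)
          show "\<forall>X\<in>J. (\<Sum>(w, \<omega>)\<leftarrow>P. w * (quantity m X \<omega> - m X)) = 0"
            using P_fair J(1) by (meson subsetD)
          show "\<exists>X\<in>J. \<exists>(w, \<omega>)\<in>set P. 0 < w \<and> \<omega> \<notin> called_off m X"
            using P_on[OF subsetD[OF J(1) E]] E by (rule bexI)
        qed (rule P_nonneg)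
        then show ?thesis ..
      next
        case False
        then have J_eq: "J = {?D |\<^sub>L ?C}" using J by blast
        have "0 < \<mu> \<or> 0 < 1 - \<mu>" by linarith
        then have "\<exists>(w, \<omega>)\<in>set Q. 0 < w \<and> \<omega> \<notin> called_off m (?D |\<^sub>L ?C)"
          unfolding Q_def using AHK_on by auto
        moreover have "(\<Sum>(w, \<omega>)\<leftarrow>Q. w * (quantity m (?D |\<^sub>L ?C) \<omega> - \<mu>)) = 0"
          unfolding Q_def by (simp add: AHK algebra_simps del: quantity.simps)
        moreover have "\<forall>(w, \<omega>)\<in>set Q. 0 \<le> w"
          using \<mu> by (simp add: Q_def)
        ultimately have "?fair Q" unfolding J_eq \<mu>_def by simp
        then show ?thesis ..
      qed
    qed
  qed
qed

theorem theorem13: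
  fixes A B H K :: "'w set"
  assumes "logically_independent4 A B H K"
  shows "(let AH = Ev (Cond A H);
              BK = Ev (Cond B K);
              AHBK = Ev (Cond A H \<and>\<^sub>L Cond B K);
              IT = Cond B K |\<^sub>L Cond A H
          in {(m AH, m BK, m AHBK, m IT) | m. coherent {AH, BK, AHBK, IT} m})
       = {(x, y, z, \<mu>) | x y z \<mu>. x \<in> {0<..1} \<and> y \<in> {0..1} \<and> z \<in> {0..min x y} \<and> \<mu> = z / x}
       \<union> {(0, y, 0, \<mu>) | y \<mu>. (y, \<mu>) \<in> {0..1} \<times> {0..1}}"
proof -
  let ?AH = "Ev (Cond A H)" and ?BK = "Ev (Cond B K)"
    and ?AHBK = "Ev (Cond A H \<and>\<^sub>L Cond B K)" and ?IT = "Cond B K |\<^sub>L Cond A H"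
  note point = logically_independent4_point[OF assms]
  obtain \<omega> where "\<omega> \<in> A - B" using point[of True False True True] by blast
  then have "Cond A H \<noteq> Cond B K" by auto
  moreover obtain \<omega> where "\<omega> \<in> - H \<inter> - K" using point[of False False False False] by blast
  then have "\<omega> \<in> antecedent (Cond A H \<and>\<^sub>L Cond B K)"
    "\<omega> \<notin> antecedent (Cond A H)" "\<omega> \<notin> antecedent (Cond B K)"
    by simp_all
  then have "Cond A H \<and>\<^sub>L Cond B K \<noteq> Cond A H" "Cond A H \<and>\<^sub>L Cond B K \<noteq> Cond B K"
    by (auto simp del: luk_conj.simps)
  ultimately have distinct: "distinct [?AH, ?BK, ?AHBK, ?IT]"
    by (auto simp del: luk_conj.simps)
  have assessment: "\<exists>m. m ?AH = x \<and> m ?BK = y \<and> m ?AHBK = z \<and> m ?IT = \<mu>" for x y z \<mu> :: real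
    by (rule exI[of _ "\<lambda>X. if X = ?AH then x else if X = ?BK then y
        else if X = ?AHBK then z else \<mu>"])
      (use distinct in \<open>auto simp del: luk_conj.simps\<close>)
  have "{(m ?AH, m ?BK, m ?AHBK, m ?IT) | m. coherent {?AH, ?BK, ?AHBK, ?IT} m}
      = {(x, y, z, \<mu>) | x y z \<mu>.
          x \<in> {0..1} \<and> y \<in> {0..1} \<and> z \<in> {0..min x y} \<and> \<mu> \<in> {0..1} \<and> z = x * \<mu>}"
    (is "?\<Pi> = ?S")
  proof
    show "?\<Pi> \<subseteq> ?S" unfolding coherent_iff[OF assms] by blast
    show "?S \<subseteq> ?\<Pi>"
    proof
      fix v assume "v \<in> ?S"
      then obtain x y z \<mu> where v: "v = (x, y, z, \<mu>)"
          "x \<in> {0..1} \<and> y \<in> {0..1} \<and> z \<in> {0..min x y} \<and> \<mu> \<in> {0..1} \<and> z = x * \<mu>"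
        by blast
      obtain m where m: "m ?AH = x" "m ?BK = y" "m ?AHBK = z" "m ?IT = \<mu>"
        using assessment[of x y z \<mu>] by (elim exE conjE)
      have "coherent {?AH, ?BK, ?AHBK, ?IT} m"
        unfolding coherent_iff[OF assms] m by (rule v(2))
      moreover have "v = (m ?AH, m ?BK, m ?AHBK, m ?IT)"
        unfolding m by (rule v(1))
      ultimately show "v \<in> ?\<Pi>" by (intro CollectI exI conjI)
    qed
  qed
  also have "?S
      = {(x, y, z, \<mu>) | x y z \<mu>. x \<in> {0<..1} \<and> y \<in> {0..1} \<and> z \<in> {0..min x y} \<and> \<mu> = z / x}
       \<union> {(0, y, 0, \<mu>) | y \<mu>. (y, \<mu>) \<in> {0..1} \<times> {0..1}}"
  proof -
    have iff: "x \<in> {0..1} \<and> y \<in> {0..1} \<and> z \<in> {0..min x y} \<and> \<mu> \<in> {0..1} \<and> z = x * \<mu>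
      \<longleftrightarrow> x \<in> {0<..1} \<and> y \<in> {0..1} \<and> z \<in> {0..min x y} \<and> \<mu> = z / x
        \<or> x = 0 \<and> z = 0 \<and> (y, \<mu>) \<in> {0..1} \<times> {0..1}" for x y z \<mu> :: real
      by (cases "x = 0") (auto simp: field_simps zero_le_mult_iff)
    show ?thesis unfolding iff by blast
  qed
  finally show ?thesis by (simp only: Let_def)
qed

end
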